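(* Consider the semi-discrete inviscid Burgers system $$\begin{bmatrix} M & 0 & 0 \\ 0 & 2 & 0 \\ 0 & 0 & 2 \end{bmatrix} \begin{pmatrix} \frac{\mathrm{d} \underline{v}(t)}{\mathrm{d}t} \\ - y_\ell(t) \\ - y_r(t) \end{pmatrix} = \begin{bmatrix} D & B_\ell & B_r \\ -B_\ell^\top & 0 & 0 \\ -B_r^\top & 0 & 0 \end{bmatrix} \begin{pmatrix} \underline{e}(t) \\ u_\ell(t) \\ u_r(t) \end{pmatrix}$$ together with the weak constitutive relation $$\int_0^1 e_d(t,x) \, \varphi^i(x) \, \mathrm{d}x = \int_0^1 \frac{v_d^2(t,x)}{2} \, \varphi^i(x) \, \mathrm{d}x, \qquad i = 1, \dots, N .$$ Then the discrete Hamiltonian $\mathcal{H}^d(\underline{v}(t)) := \mathcal{H}(v_d(t,\cdot))$ satisfies the discrete power balance $$\frac{\mathrm{d}}{\mathrm{d}t} \mathcal{H}^d(\underline{v}(t)) = u_\ell(t) \, 2 \, y_\ell(t) + u_r(t) \, 2 \, y_r(t)$$ along the smooth solutions, i.e., solutions in $\mathcal{C}^1([0,\infty); H^1(0,1))$.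
   Context: The Hamiltonian is $\mathcal{H}(v) := \int_0^1 \frac{v^3(x)}{6}\,\mathrm{d}x$. Let $\Phi = \{\varphi^i\}_{i=0}^{N+1}$, where $\{\varphi^i\}_{i=1}^N$ is a (real) finite element basis for $H^1_0(0,1)$ (linearly independent functions in $H^1_0(0,1)$), and where $\varphi^0 = d_0$, $\varphi^{N+1} = d_1$ are Dirac masses at the boundary points $0$ and $1$, used only to label the boundary degrees of freedom. For coefficient vectors $\underline{v}(t) = (v_1(t),\dots,v_N(t))^\top$ and $\underline{e}(t) = (e_1(t),\dots,e_N(t))^\top$ in $\mathbb{R}^N$, set $v_d := \sum_{i=1}^N v_i\,\varphi^i$ and $e_d := \sum_{i=1}^N e_i\,\varphi^i$. The matrices are $M, D \in \mathcal{M}_N(\mathbb{R})$ with $(M)_{ij} := \int_0^1 \varphi^j \varphi^i \,\mathrm{d}x$, $(D)_{ij} := \int_0^1 \varphi^j\, \partial_x \varphi^i \,\mathrm{d}x$, and $B_\ell, B_r \in \mathbb{R}^N$ with $(B_\ell)_i := \sqrt{2}\,\delta_{0i}$, $(B_r)_i := -\sqrt{2}\,\delta_{(N+1)i}$, where $\delta$ is the Kronecker symbol. The scalar functions $u_\ell, u_r$ are the boundary controls and $y_\ell, y_r$ the boundary observations. *)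

theory Defs
  imports "HOL-Analysis.Analysis"
begin

text \<open>Elements of the function spaces on \<open>(0,1)\<close> are represented by functions on the whole
  real line, of which only the values on \<open>(0,1)\<close> matter, up to null sets.\<close>

abbreviation unit_interval_measure :: "real measure"  (\<open>\<mu>01\<close>)
  where "\<mu>01 \<equiv> lebesgue_on {0<..<1::real}"

definition integral01 :: "(real \<Rightarrow> real) \<Rightarrow> real"
  where "integral01 f = integral\<^sup>L \<mu>01 f"

definition L2 :: "(real \<Rightarrow> real) set"
  where "L2 = {f. f \<in> borel_measurable \<mu>01 \<and> integrable \<mu>01 (\<lambda>x. (f x)\<^sup>2)}"

definition test_function :: "(real \<Rightarrow> real) \<Rightarrow> bool"
  where "test_function \<psi> \<longleftrightarrow>
    (\<forall>k x. ((deriv ^^ k) \<psi>) differentiable (at x)) \<and>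
    compact (closure {x. \<psi> x \<noteq> 0}) \<and> closure {x. \<psi> x \<noteq> 0} \<subseteq> {0<..<1}"

definition has_weak_deriv :: "(real \<Rightarrow> real) \<Rightarrow> (real \<Rightarrow> real) \<Rightarrow> bool"
  where "has_weak_deriv f g \<longleftrightarrow>
    (\<forall>\<psi>. test_function \<psi> \<longrightarrow>
      integral01 (\<lambda>x. f x * deriv \<psi> x) = - integral01 (\<lambda>x. g x * \<psi> x))"

definition H1 :: "(real \<Rightarrow> real) set"
  where "H1 = {f \<in> L2. \<exists>g\<in>L2. has_weak_deriv f g}"

text \<open>A weak derivative is only determined almost everywhere; \<open>weak_deriv\<close> picks a
  representative of it, and it is meaningful only on \<open>H1\<close>.\<close>

definition weak_deriv :: "(real \<Rightarrow> real) \<Rightarrow> real \<Rightarrow> real"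
  where "weak_deriv f = (SOME g. g \<in> L2 \<and> has_weak_deriv f g)"

definition H1_norm :: "(real \<Rightarrow> real) \<Rightarrow> real"
  where "H1_norm f =
    sqrt (integral01 (\<lambda>x. (f x)\<^sup>2) + integral01 (\<lambda>x. (weak_deriv f x)\<^sup>2))"

definition H1_0 :: "(real \<Rightarrow> real) set"
  where "H1_0 = {f \<in> H1. \<exists>\<psi> :: nat \<Rightarrow> real \<Rightarrow> real.
    (\<forall>n. test_function (\<psi> n)) \<and> (\<lambda>n. H1_norm (\<lambda>x. \<psi> n x - f x)) \<longlonglongrightarrow> 0}"

text \<open>\<open>C1_H1 u\<close> expresses \<open>u \<in> C\<^sup>1([0,\<infinity>); H\<^sup>1(0,1))\<close>; the derivative at time \<open>0\<close> is
  one-sided.\<close>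

definition C1_H1 :: "(real \<Rightarrow> real \<Rightarrow> real) \<Rightarrow> bool"
  where "C1_H1 u \<longleftrightarrow>
    (\<forall>t\<ge>0. u t \<in> H1) \<and>
    (\<exists>u' :: real \<Rightarrow> real \<Rightarrow> real. \<forall>t\<ge>0.
      u' t \<in> H1 \<and>
      ((\<lambda>s. H1_norm (\<lambda>x. (u s x - u t x) / (s - t) - u' t x)) \<longlongrightarrow> 0) (at t within {0..}) \<and>
      ((\<lambda>s. H1_norm (\<lambda>x. u' s x - u' t x)) \<longlongrightarrow> 0) (at t within {0..}))"

text \<open>Vectors in \<open>\<real>\<^sup>N\<close> and \<open>N \<times> N\<close> matrices are functions of indices in \<open>{1..N}\<close>, so that the
  labels \<open>0\<close> and \<open>N + 1\<close> remain available for the boundary degrees of freedom. The Dirac masses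
  carrying these two labels enter no formula and are not represented.\<close>

definition fe_basis :: "nat \<Rightarrow> (nat \<Rightarrow> real \<Rightarrow> real) \<Rightarrow> bool"
  where "fe_basis N \<phi> \<longleftrightarrow>
    (\<forall>i\<in>{1..N}. \<phi> i \<in> H1_0) \<and>
    (\<forall>c. (AE x in \<mu>01. (\<Sum>i=1..N. c i * \<phi> i x) = 0) \<longrightarrow> (\<forall>i\<in>{1..N}. c i = 0))"

definition fe_fun :: "nat \<Rightarrow> (nat \<Rightarrow> real \<Rightarrow> real) \<Rightarrow> (nat \<Rightarrow> real) \<Rightarrow> real \<Rightarrow> real"
  where "fe_fun N \<phi> c x = (\<Sum>i=1..N. c i * \<phi> i x)"

definition mass_matrix :: "(nat \<Rightarrow> real \<Rightarrow> real) \<Rightarrow> nat \<Rightarrow> nat \<Rightarrow> real"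
  where "mass_matrix \<phi> i j = integral01 (\<lambda>x. \<phi> j x * \<phi> i x)"

definition deriv_matrix :: "(nat \<Rightarrow> real \<Rightarrow> real) \<Rightarrow> nat \<Rightarrow> nat \<Rightarrow> real"
  where "deriv_matrix \<phi> i j = integral01 (\<lambda>x. \<phi> j x * weak_deriv (\<phi> i) x)"

definition kronecker :: "nat \<Rightarrow> nat \<Rightarrow> real"
  where "kronecker i j = (if i = j then 1 else 0)"

definition B_left :: "nat \<Rightarrow> real"
  where "B_left i = sqrt 2 * kronecker 0 i"

definition B_right :: "nat \<Rightarrow> nat \<Rightarrow> real"
  where "B_right N i = - sqrt 2 * kronecker (N + 1) i"

text \<open>The three block rows of the system are written out; the zero blocks are omitted.\<close>

definition burgers_semidiscrete ::
  "nat \<Rightarrow> (nat \<Rightarrow> real \<Rightarrow> real) \<Rightarrow> (real \<Rightarrow> nat \<Rightarrow> real) \<Rightarrow> (real \<Rightarrow> nat \<Rightarrow> real) \<Rightarrow>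
   (real \<Rightarrow> real) \<Rightarrow> (real \<Rightarrow> real) \<Rightarrow> (real \<Rightarrow> real) \<Rightarrow> (real \<Rightarrow> real) \<Rightarrow> bool"
  where "burgers_semidiscrete N \<phi> v e u_l u_r y_l y_r \<longleftrightarrow>
    (\<forall>t\<ge>0. \<exists>dv :: nat \<Rightarrow> real.
      (\<forall>i\<in>{1..N}. ((\<lambda>s. v s i) has_real_derivative dv i) (at t within {0..})) \<and>
      (\<forall>i\<in>{1..N}. (\<Sum>j=1..N. mass_matrix \<phi> i j * dv j) =
        (\<Sum>j=1..N. deriv_matrix \<phi> i j * e t j) + B_left i * u_l t + B_right N i * u_r t) \<and>
      2 * (- y_l t) = - (\<Sum>j=1..N. B_left j * e t j) \<and>
      2 * (- y_r t) = - (\<Sum>j=1..N. B_right N j * e t j))"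

definition weak_constitutive ::
  "nat \<Rightarrow> (nat \<Rightarrow> real \<Rightarrow> real) \<Rightarrow> (real \<Rightarrow> nat \<Rightarrow> real) \<Rightarrow> (real \<Rightarrow> nat \<Rightarrow> real) \<Rightarrow> bool"
  where "weak_constitutive N \<phi> v e \<longleftrightarrow>
    (\<forall>t\<ge>0. \<forall>i\<in>{1..N}.
      integral01 (\<lambda>x. fe_fun N \<phi> (e t) x * \<phi> i x) =
      integral01 (\<lambda>x. (fe_fun N \<phi> (v t) x)\<^sup>2 / 2 * \<phi> i x))"

definition hamiltonian :: "(real \<Rightarrow> real) \<Rightarrow> real"
  where "hamiltonian w = integral01 (\<lambda>x. w x ^ 3 / 6)"

definition discrete_hamiltonian :: "nat \<Rightarrow> (nat \<Rightarrow> real \<Rightarrow> real) \<Rightarrow> (nat \<Rightarrow> real) \<Rightarrow> real"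
  where "discrete_hamiltonian N \<phi> c = hamiltonian (fe_fun N \<phi> c)"

end

theory Submission
  imports Defs
begin

text \<open>The indices \<open>1..N\<close> of the basis never meet the boundary labels \<open>0\<close> and \<open>N + 1\<close>, so
  \<open>B\<^sub>\<ell>\<close>, \<open>B\<^sub>r\<close> and both observations vanish, and the discrete Hamiltonian has to be conserved.
  By the constitutive relation and the symmetry of \<open>M\<close> its time derivative
  \<open>\<integral> v\<^sub>d\<^sup>2/2 \<partial>\<^sub>t v\<^sub>d\<close> equals \<open>e \<bullet> M v' = e \<bullet> D e\<close>, which is zero because integration by parts in
  \<open>H\<^sup>1\<^sub>0\<close> makes \<open>D\<close> antisymmetric. The Hamiltonian is a cubic polynomial in the coefficients,
  since elements of \<open>H\<^sup>1\<^sub>0\<close> are essentially bounded and their triple products integrable.\<close>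

section \<open>Square-integrable functions on the unit interval\<close>

lemma finite_measure_unit_interval: "finite_measure \<mu>01"
  by (rule finite_measure_lebesgue_on) auto

lemma L2_measurable: "f \<in> L2 \<Longrightarrow> f \<in> borel_measurable \<mu>01"
  and L2_integrable_square: "f \<in> L2 \<Longrightarrow> integrable \<mu>01 (\<lambda>x. (f x)\<^sup>2)"
  by (auto simp: L2_def)

lemma L2_mult_integrable:
  assumes "f \<in> L2" "g \<in> L2"
  shows "integrable \<mu>01 (\<lambda>x. f x * g x)"
proof (rule Bochner_Integration.integrable_bound)
  show "integrable \<mu>01 (\<lambda>x. (f x)\<^sup>2 + (g x)\<^sup>2)"
    using assms by (auto simp: L2_def)
  show "(\<lambda>x. f x * g x) \<in> borel_measurable \<mu>01"
    using assms by (auto simp: L2_def)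
  have "\<bar>a * b\<bar> \<le> a\<^sup>2 + b\<^sup>2" for a b :: real
    using sum_squares_bound[of "\<bar>a\<bar>" "\<bar>b\<bar>"] mult_nonneg_nonneg[OF abs_ge_zero[of a] abs_ge_zero[of b]]
    unfolding abs_mult power2_abs by linarith
  then show "AE x in \<mu>01. norm (f x * g x) \<le> norm ((f x)\<^sup>2 + (g x)\<^sup>2)"
    by auto
qed

lemma L2_diff: "f \<in> L2 \<Longrightarrow> g \<in> L2 \<Longrightarrow> (\<lambda>x. f x - g x) \<in> L2"
  using L2_mult_integrable[of f g] by (auto simp add: L2_def power2_diff mult.assoc)

lemma integral01_mult_diff_left:
  "f \<in> L2 \<Longrightarrow> g \<in> L2 \<Longrightarrow> h \<in> L2 \<Longrightarrow>
    integral01 (\<lambda>x. (f x - g x) * h x) = integral01 (\<lambda>x. f x * h x) - integral01 (\<lambda>x. g x * h x)"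
  by (simp add: integral01_def left_diff_distrib L2_mult_integrable)

lemma integral01_square_nonneg: "0 \<le> integral01 (\<lambda>x. (f x)\<^sup>2)"
  by (simp add: integral01_def)

text \<open>The integral of \<open>(f x - t * g x)\<^sup>2\<close> is a quadratic in
  \<open>t\<close> that is nowhere negative; evaluating it at a suitable \<open>t\<close> gives the
  inequality.\<close>

lemma integral01_Cauchy_Schwarz:
  assumes "f \<in> L2" "g \<in> L2"
  shows "(integral01 (\<lambda>x. f x * g x))\<^sup>2 \<le> integral01 (\<lambda>x. (f x)\<^sup>2) * integral01 (\<lambda>x. (g x)\<^sup>2)"
proof -
  let ?A = "integral01 (\<lambda>x. (f x)\<^sup>2)" and ?B = "integral01 (\<lambda>x. f x * g x)"
    and ?C = "integral01 (\<lambda>x. (g x)\<^sup>2)"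
  have *: "0 \<le> ?A - 2 * t * ?B + t\<^sup>2 * ?C" for t
  proof -
    have "0 \<le> integral01 (\<lambda>x. (f x - t * g x)\<^sup>2)"
      by (rule integral01_square_nonneg)
    also have "(\<lambda>x. (f x - t * g x)\<^sup>2) = (\<lambda>x. (f x)\<^sup>2 - 2 * t * (f x * g x) + t\<^sup>2 * (g x)\<^sup>2)"
      by (auto simp: power2_diff power_mult_distrib)
    also have "integral01 \<dots> = ?A - 2 * t * ?B + t\<^sup>2 * ?C"
      using assms by (simp add: integral01_def L2_mult_integrable L2_integrable_square)
    finally show ?thesis .
  qed
  show ?thesis
  proof (cases "?C = 0")
    case True
    have "?B = 0"
    proof (rule ccontr)
      assume "?B \<noteq> 0"
      then show False
        \<comment> \<open>With \<open>?C = 0\<close> the quadratic is affine in \<open>t\<close>,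
          and this \<open>t\<close> makes it equal to -1.\<close>
        using *[of "(?A + 1) / (2 * ?B)"] True by simp
    qed
    then show ?thesis using True by simp
  next
    case False
    then have "?C > 0" using integral01_square_nonneg[of g] by linarith
    \<comment> \<open>The value \<open>?B / ?C\<close> is the minimiser of the quadratic.\<close>
    have "0 \<le> ?A - 2 * (?B / ?C) * ?B + (?B / ?C)\<^sup>2 * ?C" by (rule *)
    also have "\<dots> = ?A - ?B\<^sup>2 / ?C"
      using False by (simp add: power2_eq_square)
    finally show ?thesis using \<open>?C > 0\<close> by (simp add: pos_divide_le_eq)
  qed
qed

lemma integral01_mult_tendsto_0:
  assumes "f \<in> L2" "\<And>n. g n \<in> L2" "(\<lambda>n. integral01 (\<lambda>x. (g n x)\<^sup>2)) \<longlonglongrightarrow> 0"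
  shows "(\<lambda>n. integral01 (\<lambda>x. f x * g n x)) \<longlonglongrightarrow> 0"
proof -
  have "(\<lambda>n. (integral01 (\<lambda>x. f x * g n x))\<^sup>2) \<longlonglongrightarrow> 0"
  proof (rule tendsto_sandwich[OF _ _ tendsto_const])
    show "(\<lambda>n. integral01 (\<lambda>x. (f x)\<^sup>2) * integral01 (\<lambda>x. (g n x)\<^sup>2)) \<longlonglongrightarrow> 0"
      using tendsto_mult_left[OF assms(3)] by simp
  qed (use assms integral01_Cauchy_Schwarz in \<open>auto intro!: always_eventually\<close>)
  then show ?thesis by simp
qed

section \<open>Test functions\<close>

text \<open>\<open>deriv\<close> is total, so it is linear only where both derivatives exist; the
  smoothness of test functions supplies this at every order.\<close>

lemma test_function_funpow_deriv_diff:
  assumes "test_function \<psi>" "test_function \<theta>"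
  shows "(deriv ^^ k) (\<lambda>x. \<psi> x - \<theta> x) = (\<lambda>x. (deriv ^^ k) \<psi> x - (deriv ^^ k) \<theta> x)"
proof (induction k)
  case (Suc k)
  have "deriv (\<lambda>x. (deriv ^^ k) \<psi> x - (deriv ^^ k) \<theta> x) x =
      deriv ((deriv ^^ k) \<psi>) x - deriv ((deriv ^^ k) \<theta>) x" for x
    using assms by (intro deriv_diff) (auto simp: test_function_def field_differentiable_def
        real_differentiable_def)
  then show ?case using Suc by auto
qed auto

lemma test_function_diff:
  assumes "test_function \<psi>" "test_function \<theta>"
  shows "test_function (\<lambda>x. \<psi> x - \<theta> x)"
proof -
  have "{x. \<psi> x - \<theta> x \<noteq> 0} \<subseteq> {x. \<psi> x \<noteq> 0} \<union> {x. \<theta> x \<noteq> 0}" by auto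
  then have sub: "closure {x. \<psi> x - \<theta> x \<noteq> 0} \<subseteq> closure {x. \<psi> x \<noteq> 0} \<union> closure {x. \<theta> x \<noteq> 0}"
    using closure_mono by (fold closure_Un)
  have "compact (closure {x. \<psi> x \<noteq> 0} \<union> closure {x. \<theta> x \<noteq> 0})"
    using assms by (auto simp: test_function_def)
  from compact_Int_closed[OF this closed_closure] sub
  have "compact (closure {x. \<psi> x - \<theta> x \<noteq> 0})"
    by (metis Int_absorb1)
  moreover have "((deriv ^^ k) (\<lambda>x. \<psi> x - \<theta> x)) differentiable (at x)" for k x
    unfolding test_function_funpow_deriv_diff[OF assms]
    using assms by (auto simp: test_function_def)
  ultimately show ?thesis using sub assms by (auto simp: test_function_def)
qed

lemma test_function_deriv:
  assumes "test_function \<psi>"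
  shows "test_function (deriv \<psi>)"
proof -
  have "deriv \<psi> x = 0" if "x \<notin> closure {x. \<psi> x \<noteq> 0}" for x
  proof -
    \<comment> \<open>Off its closed support \<open>\<psi>\<close> vanishes on a whole
      neighbourhood, not just at the point, so its derivative vanishes there and differentiation
      does not enlarge the support.\<close>
    have "\<forall>\<^sub>F y in nhds x. y \<in> - closure {x. \<psi> x \<noteq> 0}"
      using that by (intro eventually_nhds_in_open) auto
    then have "\<forall>\<^sub>F y in nhds x. \<psi> y = 0"
      by eventually_elim (use closure_subset[of "{x. \<psi> x \<noteq> 0}"] in auto)
    then show ?thesis by (subst deriv_cong_ev[of \<psi> "\<lambda>_. 0"]) auto
  qed
  then have "{x. deriv \<psi> x \<noteq> 0} \<subseteq> closure {x. \<psi> x \<noteq> 0}" by auto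
  then have sub: "closure {x. deriv \<psi> x \<noteq> 0} \<subseteq> closure {x. \<psi> x \<noteq> 0}"
    by (rule closure_minimal) simp
  have "compact (closure {x. \<psi> x \<noteq> 0})" using assms by (simp add: test_function_def)
  from compact_Int_closed[OF this closed_closure] sub
  have "compact (closure {x. deriv \<psi> x \<noteq> 0})"
    by (metis Int_absorb1)
  moreover have "((deriv ^^ k) (deriv \<psi>)) differentiable (at x)" for k x
  proof -
    have "((deriv ^^ Suc k) \<psi>) differentiable (at x)"
      using assms unfolding test_function_def by blast
    then show ?thesis by (simp only: funpow_Suc_right o_apply)
  qed
  ultimately show ?thesis using sub assms by (auto simp: test_function_def)
qed

lemma test_function_has_deriv:
  assumes "test_function \<psi>"
  shows "(\<psi> has_real_derivative deriv \<psi> x) (at x)"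
proof -
  have "((deriv ^^ 0) \<psi>) differentiable (at x)"
    using assms unfolding test_function_def by blast
  then show ?thesis
    by (simp add: DERIV_deriv_iff_real_differentiable)
qed

lemma test_function_continuous: "test_function \<psi> \<Longrightarrow> continuous_on A \<psi>"
  by (intro continuous_at_imp_continuous_on ballI DERIV_isCont[OF test_function_has_deriv])

lemma test_function_eq_0:
  assumes "test_function \<psi>" "x \<notin> {0<..<1}"
  shows "\<psi> x = 0"
  using assms closure_subset[of "{x. \<psi> x \<noteq> 0}"] unfolding test_function_def by blast

text \<open>Continuity is required up to the endpoints, although the measure lives on the open
  interval: compactness of \<open>{0..1}\<close> then excludes blow-up at the boundary.\<close>

lemma continuous_integrable_unit_interval:
  fixes f :: "real \<Rightarrow> real"
  assumes "continuous_on {0..1} f"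
  shows "integrable \<mu>01 f"
proof -
  have "compact (f ` {0..1})" by (intro compact_continuous_image assms) auto
  then obtain C where "\<forall>x\<in>{0..1}. norm (f x) \<le> C"
    by (auto dest!: compact_imp_bounded simp: bounded_iff)
  then have "AE x in \<mu>01. norm (f x) \<le> C"
    by (intro AE_I2) (auto simp: space_restrict_space)
  moreover have "f \<in> borel_measurable \<mu>01"
    by (intro continuous_imp_measurable_on_sets_lebesgue continuous_on_subset[OF assms]) auto
  ultimately show ?thesis
    by (rule finite_measure.integrable_const_bound[OF finite_measure_unit_interval])
qed

text \<open>Passes to the Henstock-Kurzweil integral, for which the fundamental theorem of calculus
  is applied below; the two endpoints do not affect the value.\<close>

lemma integral01_eq_integral:
  fixes f :: "real \<Rightarrow> real"
  assumes "continuous_on {0..1} f"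
  shows "integral01 f = integral {0..1} f"
  unfolding integral01_def
  by (subst lebesgue_integral_eq_integral[OF continuous_integrable_unit_interval[OF assms]])
     (auto simp: integral_open_interval_real)

lemma test_function_L2:
  assumes "test_function \<psi>"
  shows "\<psi> \<in> L2"
proof -
  note cont = test_function_continuous[OF assms, of "{0..1}"]
  have "integrable \<mu>01 \<psi>" "integrable \<mu>01 (\<lambda>x. (\<psi> x)\<^sup>2)"
    by (intro continuous_integrable_unit_interval continuous_on_power cont)+
  then show ?thesis by (simp add: L2_def borel_measurable_integrable)
qed

text \<open>Product rule and fundamental theorem of calculus; the boundary terms vanish because
  \<open>\<theta>\<close> is zero at 0 and 1.\<close>

lemma test_function_has_weak_deriv:
  assumes "test_function \<psi>"
  shows "has_weak_deriv \<psi> (deriv \<psi>)"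
  unfolding has_weak_deriv_def
proof (intro allI impI)
  fix \<theta> assume \<theta>: "test_function \<theta>"
  let ?f = "\<lambda>x. \<psi> x * deriv \<theta> x + deriv \<psi> x * \<theta> x"
  note cont = test_function_continuous[OF assms] test_function_continuous[OF \<theta>]
    test_function_continuous[OF test_function_deriv[OF assms]]
    test_function_continuous[OF test_function_deriv[OF \<theta>]]
  have "((\<lambda>x. \<psi> x * \<theta> x) has_real_derivative ?f x) (at x within {0..1})" for x
    using DERIV_mult[OF test_function_has_deriv[OF assms] test_function_has_deriv[OF \<theta>], of x]
    by (simp add: has_field_derivative_at_within algebra_simps)
  then have "(?f has_integral \<psi> 1 * \<theta> 1 - \<psi> 0 * \<theta> 0) {0..1}"
    by (intro fundamental_theorem_of_calculus)
       (simp_all flip: has_real_derivative_iff_has_vector_derivative)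
  then have "integral {0..1} ?f = 0"
    using test_function_eq_0[OF \<theta>, of 0] test_function_eq_0[OF \<theta>, of 1]
    by (simp add: integral_unique)
  then have "integral01 ?f = 0"
    by (subst integral01_eq_integral) (intro continuous_intros cont)
  then show "integral01 (\<lambda>x. \<psi> x * deriv \<theta> x) = - integral01 (\<lambda>x. deriv \<psi> x * \<theta> x)"
    unfolding integral01_def
    by (subst (asm) Bochner_Integration.integral_add)
       (auto intro!: L2_mult_integrable test_function_L2 test_function_deriv assms \<theta>)
qed

text \<open>Since \<open>\<psi> 0 = 0\<close>, the value at \<open>x\<close> is the integral of
  \<open>deriv \<psi>\<close> from 0 to \<open>x\<close>. Only a uniform bound is wanted later, so
  the crude estimate of \<open>\<bar>a\<bar>\<close> by \<open>1 + a\<^sup>2\<close>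
  suffices.\<close>

lemma test_function_bound:
  assumes "test_function \<psi>"
  shows "\<bar>\<psi> x\<bar> \<le> 1 + integral01 (\<lambda>x. (deriv \<psi> x)\<^sup>2)"
proof (cases "x \<in> {0<..<1}")
  case False
  then show ?thesis
    using test_function_eq_0[OF assms] integral01_square_nonneg[of "deriv \<psi>"] by simp
next
  case True
  note cont = test_function_continuous[OF test_function_deriv[OF assms]]
  have "(deriv \<psi> has_integral \<psi> x - \<psi> 0) {0..x}"
    using True has_field_derivative_at_within[OF test_function_has_deriv[OF assms]]
    by (intro fundamental_theorem_of_calculus)
       (simp_all flip: has_real_derivative_iff_has_vector_derivative)
  then have "\<psi> x = integral {0..x} (deriv \<psi>)"
    using test_function_eq_0[OF assms, of 0] by (simp add: integral_unique)
  also have "\<bar>\<dots>\<bar> \<le> integral {0..x} (\<lambda>y. \<bar>deriv \<psi> y\<bar>)"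
    using integral_norm_bound_integral[of "deriv \<psi>" "{0..x}" "\<lambda>y. \<bar>deriv \<psi> y\<bar>"]
    by (auto intro!: integrable_continuous_real continuous_intros cont)
  also have "\<dots> \<le> integral {0..1} (\<lambda>y. \<bar>deriv \<psi> y\<bar>)"
    using True by (intro integral_subset_le)
      (auto intro!: integrable_continuous_real continuous_intros cont)
  also have "\<dots> \<le> integral {0..1} (\<lambda>y. 1 + (deriv \<psi> y)\<^sup>2)"
  proof (rule integral_le)
    have "\<bar>a\<bar> \<le> 1 + a\<^sup>2" for a :: real
      using sum_squares_bound[of 1 "\<bar>a\<bar>"] abs_ge_zero[of a] unfolding power2_abs by simp
    then show "\<bar>deriv \<psi> y\<bar> \<le> 1 + (deriv \<psi> y)\<^sup>2" for y .
  qed (auto intro!: integrable_continuous_real continuous_intros cont)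
  also have "\<dots> = 1 + integral {0..1} (\<lambda>y. (deriv \<psi> y)\<^sup>2)"
    by (subst Henstock_Kurzweil_Integration.integral_add)
       (auto intro!: integrable_continuous_real continuous_intros cont)
  also have "integral {0..1} (\<lambda>y. (deriv \<psi> y)\<^sup>2) = integral01 (\<lambda>y. (deriv \<psi> y)\<^sup>2)"
    by (rule integral01_eq_integral[symmetric]) (intro continuous_intros cont)
  finally show ?thesis .
qed

section \<open>Weak derivatives and integration by parts\<close>

lemma has_weak_deriv_diff:
  assumes "has_weak_deriv f f'" "has_weak_deriv g g'" "f \<in> L2" "f' \<in> L2" "g \<in> L2" "g' \<in> L2"
  shows "has_weak_deriv (\<lambda>x. f x - g x) (\<lambda>x. f' x - g' x)"
  using assms unfolding has_weak_deriv_def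
  by (simp add: integral01_mult_diff_left test_function_L2 test_function_deriv)

lemma weak_deriv_props:
  assumes "f \<in> H1"
  shows "weak_deriv f \<in> L2" "has_weak_deriv f (weak_deriv f)"
proof -
  have "\<exists>g. g \<in> L2 \<and> has_weak_deriv f g" using assms by (auto simp: H1_def)
  from someI_ex[OF this] show "weak_deriv f \<in> L2" "has_weak_deriv f (weak_deriv f)"
    by (auto simp: weak_deriv_def)
qed

text \<open>Splits convergence in \<open>H1_norm\<close> into two L2 limits. Every \<open>n\<close>
  yields its own weak derivative of \<open>f\<close>, namely \<open>deriv (\<psi> n)\<close> minus a
  small error \<open>h n\<close>, so that representatives chosen by \<open>weak_deriv\<close> for
  different functions need never be compared pointwise.\<close>

lemma H1_0_approx:
  assumes "f \<in> H1_0"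
  obtains \<psi> h where "\<forall>n::nat. test_function (\<psi> n)" "\<forall>n. h n \<in> L2"
    "\<forall>n. has_weak_deriv f (\<lambda>x. deriv (\<psi> n) x - h n x)"
    "(\<lambda>n. integral01 (\<lambda>x. (\<psi> n x - f x)\<^sup>2)) \<longlonglongrightarrow> 0"
    "(\<lambda>n. integral01 (\<lambda>x. (h n x)\<^sup>2)) \<longlonglongrightarrow> 0"
proof -
  from assms obtain \<psi> :: "nat \<Rightarrow> real \<Rightarrow> real" where f: "f \<in> H1" "f \<in> L2"
    and test: "\<And>n. test_function (\<psi> n)"
    and lim: "(\<lambda>n. H1_norm (\<lambda>x. \<psi> n x - f x)) \<longlonglongrightarrow> 0"
    by (auto simp: H1_0_def H1_def)
  \<comment> \<open>The error has to be this very representative, since it is the one measured by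
    \<open>H1_norm\<close>.\<close>
  define h where "h n = weak_deriv (\<lambda>x. \<psi> n x - f x)" for n
  have L2: "\<psi> n \<in> L2" "deriv (\<psi> n) \<in> L2" for n
    by (auto intro!: test_function_L2 test_function_deriv test)
  have "(\<lambda>x. \<psi> n x - f x) \<in> H1" for n
    unfolding H1_def
    using has_weak_deriv_diff[OF test_function_has_weak_deriv[OF test] weak_deriv_props(2)[OF f(1)]]
      weak_deriv_props(1)[OF f(1)] L2 f(2) by (auto intro!: L2_diff)
  then have h: "h n \<in> L2" "has_weak_deriv (\<lambda>x. \<psi> n x - f x) (h n)" for n
    by (auto simp: h_def weak_deriv_props)
  \<comment> \<open>Here \<open>f\<close> is written as \<open>\<psi> n\<close> minus the difference
    of \<open>\<psi> n\<close> and \<open>f\<close>.\<close>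
  have weak: "has_weak_deriv f (\<lambda>x. deriv (\<psi> n) x - h n x)" for n
    using has_weak_deriv_diff[OF test_function_has_weak_deriv[OF test[of n]] h(2)[of n]] L2 f(2) h(1)
    by (simp add: L2_diff)
  \<comment> \<open>Squaring removes the root; both summands are nonnegative, so each is squeezed to
    0 by the sum.\<close>
  have "(\<lambda>n. (H1_norm (\<lambda>x. \<psi> n x - f x))\<^sup>2) \<longlonglongrightarrow> 0"
    using tendsto_power[OF lim, of 2] by simp
  then have sum: "(\<lambda>n. integral01 (\<lambda>x. (\<psi> n x - f x)\<^sup>2) + integral01 (\<lambda>x. (h n x)\<^sup>2)) \<longlonglongrightarrow> 0"
    by (simp add: H1_norm_def h_def integral01_square_nonneg)
  have "(\<lambda>n. integral01 (\<lambda>x. (\<psi> n x - f x)\<^sup>2)) \<longlonglongrightarrow> 0"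
    by (rule tendsto_sandwich[OF _ _ tendsto_const sum])
       (auto intro!: always_eventually integral01_square_nonneg)
  moreover have "(\<lambda>n. integral01 (\<lambda>x. (h n x)\<^sup>2)) \<longlonglongrightarrow> 0"
    by (rule tendsto_sandwich[OF _ _ tendsto_const sum])
       (auto intro!: always_eventually integral01_square_nonneg)
  ultimately show ?thesis by (intro that[of \<psi> h] allI test h(1) weak)
qed

lemma H1_0_L2: "f \<in> H1_0 \<Longrightarrow> f \<in> L2"
  by (auto simp: H1_0_def H1_def)

lemma integral01_mult_tendsto:
  assumes "g \<in> L2" "f \<in> L2" "\<And>n. \<psi> n \<in> L2" "(\<lambda>n. integral01 (\<lambda>x. (\<psi> n x - f x)\<^sup>2)) \<longlonglongrightarrow> 0"
  shows "(\<lambda>n. integral01 (\<lambda>x. g x * \<psi> n x)) \<longlonglongrightarrow> integral01 (\<lambda>x. g x * f x)"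
proof -
  have "integral01 (\<lambda>x. g x * (\<psi> n x - f x)) =
      integral01 (\<lambda>x. g x * \<psi> n x) - integral01 (\<lambda>x. g x * f x)" for n
    using integral01_mult_diff_left[of "\<psi> n" f g] assms by (simp add: mult.commute)
  then show ?thesis
    using integral01_mult_tendsto_0[of g "\<lambda>n x. \<psi> n x - f x"] assms L2_diff
    by (simp add: LIM_zero_iff)
qed

text \<open>Density of test functions extends orthogonality to all of \<open>H1_0\<close>. Together
  with the next lemma it stands in for almost everywhere uniqueness of weak derivatives.\<close>

lemma H1_0_annihilator:
  assumes "f \<in> H1_0" "g \<in> L2" "\<And>\<psi>. test_function \<psi> \<Longrightarrow> integral01 (\<lambda>x. g x * \<psi> x) = 0"
  shows "integral01 (\<lambda>x. g x * f x) = 0"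
proof -
  from assms(1) obtain \<psi> h where "\<forall>n::nat. test_function (\<psi> n)" "\<forall>n. h n \<in> L2"
    "\<forall>n. has_weak_deriv f (\<lambda>x. deriv (\<psi> n) x - h n x)"
    "(\<lambda>n. integral01 (\<lambda>x. (\<psi> n x - f x)\<^sup>2)) \<longlonglongrightarrow> 0"
    "(\<lambda>n. integral01 (\<lambda>x. (h n x)\<^sup>2)) \<longlonglongrightarrow> 0"
    by (rule H1_0_approx)
  with integral01_mult_tendsto[OF assms(2) H1_0_L2[OF assms(1)], of \<psi>] assms(3)
  show ?thesis by (simp add: test_function_L2 LIMSEQ_const_iff)
qed

lemma weak_deriv_diff_annihilates:
  assumes "has_weak_deriv f g" "has_weak_deriv f h" "g \<in> L2" "h \<in> L2" "test_function \<psi>"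
  shows "integral01 (\<lambda>x. (g x - h x) * \<psi> x) = 0"
  using assms by (simp add: integral01_mult_diff_left test_function_L2 has_weak_deriv_def)

text \<open>Only \<open>g\<close> is approximated: for a test function in place of \<open>g\<close>
  the identity is the definition of a weak derivative of \<open>f\<close>. The derivatives
  \<open>f'\<close> and \<open>g'\<close> are arbitrary L2 representatives, so the result covers
  those picked by \<open>weak_deriv\<close>.\<close>

lemma H1_0_integration_by_parts:
  assumes "f \<in> H1_0" "g \<in> H1_0" "has_weak_deriv f f'" "has_weak_deriv g g'" "f' \<in> L2" "g' \<in> L2"
  shows "integral01 (\<lambda>x. f x * g' x) = - integral01 (\<lambda>x. f' x * g x)"
proof -
  from assms(2) obtain \<psi> h where test': "\<forall>n::nat. test_function (\<psi> n)"
    and h': "\<forall>n. h n \<in> L2" "\<forall>n. has_weak_deriv g (\<lambda>x. deriv (\<psi> n) x - h n x)"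
    and lim: "(\<lambda>n. integral01 (\<lambda>x. (\<psi> n x - g x)\<^sup>2)) \<longlonglongrightarrow> 0"
      "(\<lambda>n. integral01 (\<lambda>x. (h n x)\<^sup>2)) \<longlonglongrightarrow> 0"
    by (rule H1_0_approx)
  note test = test'[rule_format] and h = h'[rule_format]
  note L2 = test_function_L2[OF test] test_function_L2[OF test_function_deriv[OF test]]
    h(1) H1_0_L2[OF assms(1)] H1_0_L2[OF assms(2)] assms(5,6)
  have "integral01 (\<lambda>x. f x * g' x) = - integral01 (\<lambda>x. f' x * \<psi> n x) - integral01 (\<lambda>x. f x * h n x)"
    for n
  proof -
    \<comment> \<open>Both \<open>g'\<close> and \<open>deriv (\<psi> n)\<close> minus
      \<open>h n\<close> are weak derivatives of \<open>g\<close>, hence indistinguishable when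
      paired with \<open>f\<close>.\<close>
    have "integral01 (\<lambda>x. (g' x - (deriv (\<psi> n) x - h n x)) * f x) = 0"
    proof (rule H1_0_annihilator[OF assms(1)])
      show "integral01 (\<lambda>x. (g' x - (deriv (\<psi> n) x - h n x)) * \<theta> x) = 0"
        if "test_function \<theta>" for \<theta>
        by (intro weak_deriv_diff_annihilates[OF assms(4) h(2)] L2_diff L2 that)
    qed (intro L2_diff L2)
    then have "integral01 (\<lambda>x. g' x * f x) =
        integral01 (\<lambda>x. deriv (\<psi> n) x * f x) - integral01 (\<lambda>x. h n x * f x)"
      by (simp add: integral01_mult_diff_left L2_diff L2)
    moreover have "integral01 (\<lambda>x. f x * deriv (\<psi> n) x) = - integral01 (\<lambda>x. f' x * \<psi> n x)"
      using assms(3) test by (simp add: has_weak_deriv_def)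
    ultimately show ?thesis by (simp add: mult.commute)
  qed
  \<comment> \<open>The sequence is constant in \<open>n\<close>; its limit is now computed a second
    time, term by term.\<close>
  then have "(\<lambda>n. - integral01 (\<lambda>x. f' x * \<psi> n x) - integral01 (\<lambda>x. f x * h n x))
      \<longlonglongrightarrow> integral01 (\<lambda>x. f x * g' x)" by simp
  moreover have "(\<lambda>n. - integral01 (\<lambda>x. f' x * \<psi> n x) - integral01 (\<lambda>x. f x * h n x))
      \<longlonglongrightarrow> - integral01 (\<lambda>x. f' x * g x) - 0"
    by (intro tendsto_intros integral01_mult_tendsto integral01_mult_tendsto_0 lim L2)
  ultimately have "integral01 (\<lambda>x. f x * g' x) = - integral01 (\<lambda>x. f' x * g x) - 0"
    by (rule LIMSEQ_unique)
  then show ?thesis by simp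
qed

section \<open>Essential boundedness and triple products\<close>

text \<open>The approximating test functions obey one uniform bound \<open>C\<close> from some index
  on, because their derivatives stay bounded in L2. The excess of \<open>\<bar>f\<bar>\<close> over
  \<open>C\<close> is then dominated by the approximation error, so no almost everywhere convergent
  subsequence has to be extracted.\<close>

lemma H1_0_bounded:
  assumes "f \<in> H1_0"
  obtains C where "AE x in \<mu>01. \<bar>f x\<bar> \<le> C"
proof -
  from assms obtain \<psi> h where test': "\<forall>n::nat. test_function (\<psi> n)"
    and h': "\<forall>n. h n \<in> L2" "\<forall>n. has_weak_deriv f (\<lambda>x. deriv (\<psi> n) x - h n x)"
    and lim: "(\<lambda>n. integral01 (\<lambda>x. (\<psi> n x - f x)\<^sup>2)) \<longlonglongrightarrow> 0"
      "(\<lambda>n. integral01 (\<lambda>x. (h n x)\<^sup>2)) \<longlonglongrightarrow> 0"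
    by (rule H1_0_approx)
  note test = test'[rule_format] and h = h'[rule_format]
  note f = H1_0_L2[OF assms]
  have dL2: "deriv (\<psi> n) \<in> L2" for n
    by (intro test_function_L2 test_function_deriv test)
  obtain m where m: "\<And>n. n \<ge> m \<Longrightarrow> integral01 (\<lambda>x. (h n x)\<^sup>2) < 1"
    using order_tendstoD(2)[OF lim(2), of 1] by (auto simp: eventually_sequentially)
  text \<open>Two weak derivatives of \<open>f\<close> agree against test functions, in particular against
    \<open>\<psi>\<^sub>n' - \<psi>\<^sub>m'\<close> itself; this controls \<open>\<psi>\<^sub>n'\<close> without the uniqueness of weak derivatives.\<close>
  have deriv_bound: "integral01 (\<lambda>x. (deriv (\<psi> n) x - deriv (\<psi> m) x)\<^sup>2) \<le> 4" if "n \<ge> m" for n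
  proof -
    let ?d = "\<lambda>x. deriv (\<psi> n) x - deriv (\<psi> m) x" and ?h = "\<lambda>x. h n x - h m x"
    have L2: "?d \<in> L2" "?h \<in> L2" by (intro L2_diff dL2 h)+
    have "integral01 (\<lambda>x. ((deriv (\<psi> n) x - h n x) - (deriv (\<psi> m) x - h m x)) * ?d x) = 0"
      by (intro weak_deriv_diff_annihilates[OF h(2) h(2)] L2_diff dL2 h
          test_function_diff test_function_deriv test)
    also have "(\<lambda>x. ((deriv (\<psi> n) x - h n x) - (deriv (\<psi> m) x - h m x)) * ?d x) =
        (\<lambda>x. (?d x - ?h x) * ?d x)" by (simp add: algebra_simps)
    finally have "integral01 (\<lambda>x. (?d x)\<^sup>2) = integral01 (\<lambda>x. ?h x * ?d x)"
      by (subst (asm) integral01_mult_diff_left[OF L2 L2(1)]) (simp add: power2_eq_square)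
    \<comment> \<open>Only half of the square of \<open>?d\<close> appears on the right and is
      absorbed on the left; the other two integrals are below 1, and doubling gives the constant
      4.\<close>
    also have "\<dots> \<le> integral01 (\<lambda>x. (h n x)\<^sup>2 + (h m x)\<^sup>2 + (?d x)\<^sup>2 / 2)"
      unfolding integral01_def
    proof (rule integral_mono)
      have "(p - q) * b \<le> p\<^sup>2 + q\<^sup>2 + b\<^sup>2 / 2" for p q b :: real
      proof -
        have "0 \<le> (p + q)\<^sup>2 + (p - q - b)\<^sup>2" by simp
        also have "\<dots> = 2 * (p\<^sup>2 + q\<^sup>2 + b\<^sup>2 / 2 - (p - q) * b)"
          by (simp add: power2_eq_square algebra_simps)
        finally show ?thesis by simp
      qed
      then show "?h x * ?d x \<le> (h n x)\<^sup>2 + (h m x)\<^sup>2 + (?d x)\<^sup>2 / 2" for x .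
    qed (auto intro!: L2_mult_integrable L2 L2_integrable_square h)
    also have "\<dots> = integral01 (\<lambda>x. (h n x)\<^sup>2) + integral01 (\<lambda>x. (h m x)\<^sup>2)
        + integral01 (\<lambda>x. (?d x)\<^sup>2) / 2"
      using L2_integrable_square[OF L2(1)] h(1) by (simp add: integral01_def L2_integrable_square)
    finally show ?thesis using m[of n] m[of m] that by simp
  qed
  \<comment> \<open>The 6 is 1 + 4 from \<open>test_function_bound\<close> for the difference of
    \<open>\<psi> n\<close> and \<open>\<psi> m\<close>, plus 1 from the same bound for
    \<open>\<psi> m\<close>.\<close>
  define C where "C = 6 + integral01 (\<lambda>x. (deriv (\<psi> m) x)\<^sup>2)"
  have bound: "\<bar>\<psi> n x\<bar> \<le> C" if "n \<ge> m" for n x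
  proof -
    have "deriv (\<lambda>x. \<psi> n x - \<psi> m x) = (\<lambda>x. deriv (\<psi> n) x - deriv (\<psi> m) x)"
      using test_function_funpow_deriv_diff[OF test[of n] test[of m], of 1] by simp
    with test_function_bound[OF test_function_diff[OF test[of n] test[of m]], of x] deriv_bound[OF that]
    have "\<bar>\<psi> n x - \<psi> m x\<bar> \<le> 5" by simp
    with test_function_bound[OF test[of m], of x] show ?thesis by (simp add: C_def)
  qed
  let ?e = "\<lambda>x. max 0 (\<bar>f x\<bar> - C)"
  have e_meas: "?e \<in> borel_measurable \<mu>01" using L2_measurable[OF f] by measurable
  have e_le: "(?e x)\<^sup>2 \<le> (f x)\<^sup>2" for x
    \<comment> \<open>The bound at index \<open>m\<close> serves here to show that \<open>C\<close>
      is nonnegative.\<close>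
    using bound[of m x] by (intro abs_le_square_iff[THEN iffD1]) auto
  have e_int: "integrable \<mu>01 (\<lambda>x. (?e x)\<^sup>2)"
    using e_meas e_le by (intro Bochner_Integration.integrable_bound[OF L2_integrable_square[OF f]]) auto
  have "integral01 (\<lambda>x. (?e x)\<^sup>2) \<le> integral01 (\<lambda>x. (\<psi> n x - f x)\<^sup>2)" if "n \<ge> m" for n
    unfolding integral01_def
  proof (rule integral_mono[OF e_int])
    show "integrable \<mu>01 (\<lambda>x. (\<psi> n x - f x)\<^sup>2)"
      by (intro L2_integrable_square L2_diff test_function_L2 test f)
    \<comment> \<open>Reverse triangle inequality: where \<open>\<bar>f x\<bar>\<close> exceeds
      \<open>C\<close>, it exceeds \<open>\<bar>\<psi> n x\<bar>\<close> by at least as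
      much.\<close>
    show "(?e x)\<^sup>2 \<le> (\<psi> n x - f x)\<^sup>2" for x
      using bound[OF that, of x] by (intro abs_le_square_iff[THEN iffD1]) auto
  qed
  then have "integral01 (\<lambda>x. (?e x)\<^sup>2) \<le> 0"
    by (intro LIMSEQ_le_const[OF lim(1)]) auto
  then have "integral01 (\<lambda>x. (?e x)\<^sup>2) = 0"
    using integral01_square_nonneg by (rule antisym)
  then have "AE x in \<mu>01. (?e x)\<^sup>2 = 0"
    unfolding integral01_def using integral_nonneg_eq_0_iff_AE[OF e_int] by simp
  then have "AE x in \<mu>01. \<bar>f x\<bar> \<le> C" by eventually_elim auto
  then show ?thesis using that by blast
qed

text \<open>One factor is essentially bounded, and the product of the other two is integrable as a
  product of L2 functions.\<close>

lemma H1_0_triple_integrable: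
  assumes "f \<in> H1_0" "g \<in> H1_0" "h \<in> H1_0"
  shows "integrable \<mu>01 (\<lambda>x. f x * g x * h x)"
proof -
  from H1_0_bounded[OF assms(3)] obtain C where C: "AE x in \<mu>01. \<bar>h x\<bar> \<le> C" .
  show ?thesis
  proof (rule Bochner_Integration.integrable_bound)
    show "integrable \<mu>01 (\<lambda>x. C * (f x * g x))"
      using assms by (simp add: L2_mult_integrable H1_0_L2)
    show "(\<lambda>x. f x * g x * h x) \<in> borel_measurable \<mu>01"
      using assms by (auto dest!: H1_0_L2 L2_measurable)
    show "AE x in \<mu>01. norm (f x * g x * h x) \<le> norm (C * (f x * g x))"
      using C
    proof eventually_elim
      case (elim x)
      then have "\<bar>f x * g x\<bar> * \<bar>h x\<bar> \<le> \<bar>f x * g x\<bar> * \<bar>C\<bar>"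
        by (intro mult_left_mono) auto
      then show ?case by (simp add: abs_mult mult_ac)
    qed
  qed
qed

section \<open>Finite element expansions and the derivative of the Hamiltonian\<close>

text \<open>Expands a single finite element factor against an arbitrary cofactor \<open>g\<close>,
  so it can be iterated on products; integrability is passed on for the next round.\<close>

lemma fe_fun_mult_integral:
  assumes "\<And>i. i \<in> {1..N} \<Longrightarrow> integrable \<mu>01 (\<lambda>x. \<phi> i x * g x)"
  shows "integrable \<mu>01 (\<lambda>x. fe_fun N \<phi> c x * g x)"
    and "integral01 (\<lambda>x. fe_fun N \<phi> c x * g x) = (\<Sum>i=1..N. c i * integral01 (\<lambda>x. \<phi> i x * g x))"
proof -
  have eq: "(\<lambda>x. fe_fun N \<phi> c x * g x) = (\<lambda>x. \<Sum>i=1..N. c i * (\<phi> i x * g x))"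
    by (simp add: fe_fun_def sum_distrib_right mult.assoc)
  show "integrable \<mu>01 (\<lambda>x. fe_fun N \<phi> c x * g x)"
    unfolding eq using assms by (intro Bochner_Integration.integrable_sum) auto
  show "integral01 (\<lambda>x. fe_fun N \<phi> c x * g x) = (\<Sum>i=1..N. c i * integral01 (\<lambda>x. \<phi> i x * g x))"
    unfolding eq integral01_def using assms
    by (subst Bochner_Integration.integral_sum) auto
qed

lemma fe_fun_triple_integral:
  assumes "\<And>i. i \<in> {1..N} \<Longrightarrow> \<phi> i \<in> H1_0"
  shows "integral01 (\<lambda>x. fe_fun N \<phi> a x * fe_fun N \<phi> b x * fe_fun N \<phi> c x) =
    (\<Sum>i=1..N. \<Sum>j=1..N. \<Sum>k=1..N.
      a i * b j * c k * integral01 (\<lambda>x. \<phi> i x * \<phi> j x * \<phi> k x))"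
proof -
  \<comment> \<open>Facts \<open>1\<close> to \<open>3\<close> replace basis functions by expansions
    one factor at a time; the factor to be expanded next always stands first.\<close>
  have 1: "integrable \<mu>01 (\<lambda>x. \<phi> k x * (\<phi> i x * \<phi> j x))"
    if "i \<in> {1..N}" "j \<in> {1..N}" "k \<in> {1..N}" for i j k
    using H1_0_triple_integrable[of "\<phi> k" "\<phi> i" "\<phi> j"] assms that by (simp add: mult.assoc)
  have 2: "integrable \<mu>01 (\<lambda>x. \<phi> j x * (fe_fun N \<phi> c x * \<phi> i x))"
    if "i \<in> {1..N}" "j \<in> {1..N}" for i j
    using fe_fun_mult_integral(1)[of N \<phi> "\<lambda>x. \<phi> i x * \<phi> j x" c] 1 that by (simp add: mult_ac)
  have 3: "integrable \<mu>01 (\<lambda>x. \<phi> i x * (fe_fun N \<phi> b x * fe_fun N \<phi> c x))"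
    if "i \<in> {1..N}" for i
    using fe_fun_mult_integral(1)[of N \<phi> "\<lambda>x. fe_fun N \<phi> c x * \<phi> i x" b] 2 that
    by (simp add: mult_ac)
  have 4: "integral01 (\<lambda>x. \<phi> i x * (fe_fun N \<phi> b x * fe_fun N \<phi> c x)) =
      (\<Sum>j=1..N. b j * (\<Sum>k=1..N. c k * integral01 (\<lambda>x. \<phi> i x * \<phi> j x * \<phi> k x)))"
    if i: "i \<in> {1..N}" for i
  proof -
    have "integral01 (\<lambda>x. fe_fun N \<phi> c x * (\<phi> i x * \<phi> j x)) =
        (\<Sum>k=1..N. c k * integral01 (\<lambda>x. \<phi> k x * (\<phi> i x * \<phi> j x)))" if "j \<in> {1..N}" for j
      by (rule fe_fun_mult_integral(2)) (rule 1[OF i that])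
    moreover have "integral01 (\<lambda>x. fe_fun N \<phi> b x * (fe_fun N \<phi> c x * \<phi> i x)) =
        (\<Sum>j=1..N. b j * integral01 (\<lambda>x. \<phi> j x * (fe_fun N \<phi> c x * \<phi> i x)))"
      by (rule fe_fun_mult_integral(2)) (rule 2[OF i])
    ultimately show ?thesis by (simp add: mult_ac)
  qed
  have "integral01 (\<lambda>x. fe_fun N \<phi> a x * (fe_fun N \<phi> b x * fe_fun N \<phi> c x)) =
      (\<Sum>i=1..N. a i * integral01 (\<lambda>x. \<phi> i x * (fe_fun N \<phi> b x * fe_fun N \<phi> c x)))"
    by (rule fe_fun_mult_integral(2)[OF 3])
  then show ?thesis by (simp add: 4 sum_distrib_left mult.assoc)
qed

text \<open>As a cubic form in the coefficients with constant integrals \<open>?T i j k\<close>, the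
  Hamiltonian is differentiated by the product rule alone, with no differentiation under the
  integral sign.\<close>

lemma discrete_hamiltonian_has_derivative:
  assumes "\<And>i. i \<in> {1..N} \<Longrightarrow> \<phi> i \<in> H1_0"
    and "\<And>i. i \<in> {1..N} \<Longrightarrow> ((\<lambda>s. v s i) has_real_derivative dv i) (at t within A)"
  shows "((\<lambda>s. discrete_hamiltonian N \<phi> (v s)) has_real_derivative
    integral01 (\<lambda>x. fe_fun N \<phi> dv x * ((fe_fun N \<phi> (v t) x)\<^sup>2 / 2))) (at t within A)"
proof -
  let ?T = "\<lambda>i j k. integral01 (\<lambda>x. \<phi> i x * \<phi> j x * \<phi> k x)"
  let ?F = "\<lambda>a b c. \<Sum>i=1..N. \<Sum>j=1..N. \<Sum>k=1..N. a i * b j * c k * ?T i j k"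
  let ?I = "integral01 (\<lambda>x. fe_fun N \<phi> dv x * ((fe_fun N \<phi> (v t) x)\<^sup>2 / 2))"
  have F: "?F a b c = integral01 (\<lambda>x. fe_fun N \<phi> a x * fe_fun N \<phi> b x * fe_fun N \<phi> c x)" for a b c
    by (rule fe_fun_triple_integral[symmetric]) (rule assms(1))
  have H: "discrete_hamiltonian N \<phi> c = ?F c c c / 6" for c
    unfolding F by (simp add: discrete_hamiltonian_def hamiltonian_def integral01_def power3_eq_cube)
  have I: "?I = integral01 (\<lambda>x. fe_fun N \<phi> dv x * fe_fun N \<phi> (v t) x * fe_fun N \<phi> (v t) x) / 2"
    by (simp add: integral01_def power2_eq_square mult_ac)
  have D: "((\<lambda>s. v s i * v s j * v s k * ?T i j k) has_real_derivative dv i * v t j * v t k * ?T i j k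
        + v t i * dv j * v t k * ?T i j k + v t i * v t j * dv k * ?T i j k) (at t within A)"
    if "i \<in> {1..N}" "j \<in> {1..N}" "k \<in> {1..N}" for i j k
    by (rule DERIV_cong[OF DERIV_cmult_right[OF DERIV_mult[OF
          DERIV_mult[OF assms(2)[OF that(1)] assms(2)[OF that(2)]] assms(2)[OF that(3)]]]])
       (simp add: algebra_simps)
  have "((\<lambda>s. ?F (v s) (v s) (v s)) has_real_derivative
      (\<Sum>i=1..N. \<Sum>j=1..N. \<Sum>k=1..N. dv i * v t j * v t k * ?T i j k
        + v t i * dv j * v t k * ?T i j k + v t i * v t j * dv k * ?T i j k)) (at t within A)"
    by (intro DERIV_sum D)
  also have "(\<Sum>i=1..N. \<Sum>j=1..N. \<Sum>k=1..N. dv i * v t j * v t k * ?T i j k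
        + v t i * dv j * v t k * ?T i j k + v t i * v t j * dv k * ?T i j k) =
      ?F dv (v t) (v t) + ?F (v t) dv (v t) + ?F (v t) (v t) dv"
    by (simp add: sum.distrib)
  \<comment> \<open>The three terms agree by symmetry, and each is \<open>2 * ?I\<close> because of
    the half inside \<open>?I\<close>; this cancels the 1/6 of the Hamiltonian.\<close>
  also have "\<dots> = 6 * ?I"
    unfolding F I by (simp add: mult_ac)
  finally have "((\<lambda>s. ?F (v s) (v s) (v s) / 6) has_real_derivative 6 * ?I / 6) (at t within A)"
    by (rule DERIV_cdivide)
  then show ?thesis unfolding H by simp
qed

section \<open>The power balance\<close>

lemma deriv_matrix_antisymmetric:
  assumes "\<phi> i \<in> H1_0" "\<phi> j \<in> H1_0"
  shows "deriv_matrix \<phi> i j = - deriv_matrix \<phi> j i"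
proof -
  have "\<phi> i \<in> H1" "\<phi> j \<in> H1" using assms by (auto simp: H1_0_def)
  then show ?thesis
    using H1_0_integration_by_parts[OF assms(2,1), of "weak_deriv (\<phi> j)" "weak_deriv (\<phi> i)"]
    by (simp add: weak_deriv_props deriv_matrix_def mult.commute)
qed

theorem proposition5:
  fixes N :: nat
    and \<phi> :: "nat \<Rightarrow> real \<Rightarrow> real"
    and v e :: "real \<Rightarrow> nat \<Rightarrow> real"
    and u_l u_r y_l y_r :: "real \<Rightarrow> real"
  assumes "fe_basis N \<phi>"
    and "burgers_semidiscrete N \<phi> v e u_l u_r y_l y_r"
    and "weak_constitutive N \<phi> v e"
    and "C1_H1 (\<lambda>t. fe_fun N \<phi> (v t))"
  shows "\<forall>t\<ge>0. ((\<lambda>s. discrete_hamiltonian N \<phi> (v s)) has_real_derivative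
            u_l t * (2 * y_l t) + u_r t * (2 * y_r t)) (at t within {0..})"
proof (intro allI impI)
  fix t :: real assume t: "t \<ge> 0"
  have \<phi>: "\<phi> i \<in> H1_0" if "i \<in> {1..N}" for i
    using assms(1) that by (auto simp: fe_basis_def)
  have B: "B_left i = 0" "B_right N i = 0" if "i \<in> {1..N}" for i
    using that by (auto simp: B_left_def B_right_def kronecker_def)
  obtain dv where
    dv: "\<forall>i\<in>{1..N}. ((\<lambda>s. v s i) has_real_derivative dv i) (at t within {0..})"
    and sys: "\<forall>i\<in>{1..N}. (\<Sum>j=1..N. mass_matrix \<phi> i j * dv j) =
        (\<Sum>j=1..N. deriv_matrix \<phi> i j * e t j) + B_left i * u_l t + B_right N i * u_r t"
    and y: "2 * (- y_l t) = - (\<Sum>j=1..N. B_left j * e t j)"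
      "2 * (- y_r t) = - (\<Sum>j=1..N. B_right N j * e t j)"
    using assms(2) t unfolding burgers_semidiscrete_def by blast
  have y0: "y_l t = 0" "y_r t = 0" using y by (simp_all add: B)
  have L2_prod: "integrable \<mu>01 (\<lambda>x. \<phi> i x * \<phi> j x)" if "i \<in> {1..N}" "j \<in> {1..N}" for i j
    using \<phi> that by (intro L2_mult_integrable H1_0_L2) auto
  have mass: "integral01 (\<lambda>x. fe_fun N \<phi> (e t) x * \<phi> i x) = (\<Sum>j=1..N. e t j * mass_matrix \<phi> i j)"
    if "i \<in> {1..N}" for i
    unfolding mass_matrix_def by (rule fe_fun_mult_integral(2)) (rule L2_prod[OF _ that])
  have cubic: "integrable \<mu>01 (\<lambda>x. \<phi> i x * ((fe_fun N \<phi> (v t) x)\<^sup>2 / 2))" if "i \<in> {1..N}" for i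
  proof -
    have "integrable \<mu>01 (\<lambda>x. fe_fun N \<phi> (v t) x * (fe_fun N \<phi> (v t) x * \<phi> i x))"
    proof (rule fe_fun_mult_integral(1))
      fix j assume j: "j \<in> {1..N}"
      have "integrable \<mu>01 (\<lambda>x. fe_fun N \<phi> (v t) x * (\<phi> i x * \<phi> j x))"
        by (rule fe_fun_mult_integral(1))
           (use H1_0_triple_integrable \<phi> that j in \<open>auto simp flip: mult.assoc\<close>)
      then show "integrable \<mu>01 (\<lambda>x. \<phi> j x * (fe_fun N \<phi> (v t) x * \<phi> i x))"
        by (simp add: mult_ac)
    qed
    then show ?thesis by (simp add: power2_eq_square mult_ac)
  qed
  have "integral01 (\<lambda>x. fe_fun N \<phi> dv x * ((fe_fun N \<phi> (v t) x)\<^sup>2 / 2)) =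
      (\<Sum>i=1..N. dv i * integral01 (\<lambda>x. \<phi> i x * ((fe_fun N \<phi> (v t) x)\<^sup>2 / 2)))"
    by (rule fe_fun_mult_integral(2)[OF cubic])
  also have "\<dots> = (\<Sum>i=1..N. dv i * integral01 (\<lambda>x. fe_fun N \<phi> (e t) x * \<phi> i x))"
    using assms(3) t by (intro sum.cong refl) (simp add: weak_constitutive_def mult.commute)
  also have "\<dots> = (\<Sum>i=1..N. dv i * (\<Sum>j=1..N. e t j * mass_matrix \<phi> i j))"
    by (simp add: mass)
  \<comment> \<open>Symmetry of the mass matrix turns the coefficient of \<open>e t j\<close> into
    row \<open>j\<close> of the left side of the system.\<close>
  also have "\<dots> = (\<Sum>j=1..N. e t j * (\<Sum>i=1..N. mass_matrix \<phi> j i * dv i))"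
    by (simp add: sum_distrib_left, subst sum.swap) (simp add: mass_matrix_def mult_ac)
  also have "\<dots> = (\<Sum>j=1..N. e t j * (\<Sum>i=1..N. deriv_matrix \<phi> j i * e t i))"
    using sys by (intro sum.cong refl) (simp add: B)
  also have "\<dots> = 0"
  proof -
    \<comment> \<open>Exchanging the two summation indices sends this quadratic form to its own
      negative.\<close>
    let ?S = "\<Sum>j=1..N. \<Sum>i=1..N. e t j * (deriv_matrix \<phi> j i * e t i)"
    have anti: "e t j * (deriv_matrix \<phi> j i * e t i) = - (e t i * (deriv_matrix \<phi> i j * e t j))"
      if "i \<in> {1..N}" "j \<in> {1..N}" for i j
      using deriv_matrix_antisymmetric[OF \<phi> \<phi>, OF that(2,1)] by simp
    have "?S = (\<Sum>i=1..N. \<Sum>j=1..N. e t j * (deriv_matrix \<phi> j i * e t i))"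
      by (rule sum.swap)
    also have "\<dots> = (\<Sum>i=1..N. \<Sum>j=1..N. - (e t i * (deriv_matrix \<phi> i j * e t j)))"
      by (intro sum.cong refl anti)
    also have "\<dots> = - ?S" by (simp add: sum_negf)
    finally show ?thesis by (simp add: sum_distrib_left)
  qed
  \<comment> \<open>Both sides are 0: the supplied power vanishes with the observations, whatever
    the controls are.\<close>
  finally have "integral01 (\<lambda>x. fe_fun N \<phi> dv x * ((fe_fun N \<phi> (v t) x)\<^sup>2 / 2)) =
      u_l t * (2 * y_l t) + u_r t * (2 * y_r t)"
    by (simp add: y0)
  moreover have "((\<lambda>s. discrete_hamiltonian N \<phi> (v s)) has_real_derivative
      integral01 (\<lambda>x. fe_fun N \<phi> dv x * ((fe_fun N \<phi> (v t) x)\<^sup>2 / 2))) (at t within {0..})"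
    by (rule discrete_hamiltonian_has_derivative) (rule \<phi>, assumption, rule dv[rule_format])
  ultimately show "((\<lambda>s. discrete_hamiltonian N \<phi> (v s)) has_real_derivative
      u_l t * (2 * y_l t) + u_r t * (2 * y_r t)) (at t within {0..})"
    by simp
qed

end
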